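(* Distributed updates can speed up the update process by a factor of $O(n)$, with respect to message propagation delay, where $n$ is the number of nodes of the network.
   Context: The network is a connected graph $G=(V,E)$ with $n$ nodes (switches, routers) with unique identifiers and with full-duplex links, equipped with a logically centralized controller that can collect the network state and send network updates to the nodes; the controller is connected to or placed on some node. The update process is the migration of the nodes from old to new forwarding rules for a destination $d$ in a loop-free fashion, meaning that the forwarding rules never contain a loop during the migration, even under asynchrony (nodes that are updated in the same round may change their rules in any order). Centralized updates: the controller sends out update commands, needs to obtain an acknowledgement of each update, and in turn sends out the next update command. Distributed updates: the controller sends update labels out to the nodes (it may pipeline their distribution), and the nodes then decide locally when to apply them, without further interaction with the controller. For destination-based routing, the label of a node specifies its parent and its depth in the new forwarding tree towards $d$; a node $v$ waits until its new parent $w$ has updated, and then updates only if $\mathrm{depth}(v)=\mathrm{depth}(w)+1$. Nodes inform their neighbors when their label state changes. Message propagation delay: the time taken by messages to travel through the network, where one hop is assumed to take unit time. The observation concerns the theoretical speed up of distributed over centralized updates that is possible in extreme cases. *)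

theory Defs
  imports Complex_Main "HOL-Library.Landau_Symbols"
begin

text \<open>
  The unique identifiers of the nodes are natural numbers.  A migration consists of the network
  with its controller, the destination, and the parent functions of the old and the new forwarding
  rules; the value of a parent function at the destination is irrelevant.
\<close>

record network =
  nodes :: "nat set"
  links :: "(nat \<times> nat) set"
  controller :: nat

record migration = network +
  dest :: nat
  old_rule :: "nat \<Rightarrow> nat"
  new_rule :: "nat \<Rightarrow> nat"

text \<open>A full-duplex link is represented by both of its orientations.\<close>

definition network_wf :: "'a network_scheme \<Rightarrow> bool" where
  "network_wf N \<longleftrightarrow>
     finite (nodes N) \<and> links N \<subseteq> nodes N \<times> nodes N \<and> sym (links N) \<and> irrefl (links N) \<and>
     (\<forall>u\<in>nodes N. \<forall>v\<in>nodes N. (u, v) \<in> (links N)\<^sup>*) \<and> controller N \<in> nodes N"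

definition hops :: "'a network_scheme \<Rightarrow> nat \<Rightarrow> nat \<Rightarrow> nat" where
  "hops N u v = (LEAST k. (u, v) \<in> links N ^^ k)"

definition forwarding :: "migration \<Rightarrow> (nat \<Rightarrow> nat) \<Rightarrow> (nat \<times> nat) set" where
  "forwarding M p = {(v, p v) |v. v \<in> nodes M - {dest M}}"

definition forwarding_tree :: "migration \<Rightarrow> (nat \<Rightarrow> nat) \<Rightarrow> bool" where
  "forwarding_tree M p \<longleftrightarrow>
     forwarding M p \<subseteq> links M \<and> (\<forall>v\<in>nodes M. (v, dest M) \<in> (forwarding M p)\<^sup>*)"

definition migration_wf :: "migration \<Rightarrow> bool" where
  "migration_wf M \<longleftrightarrow>
     network_wf M \<and> dest M \<in> nodes M \<and>
     forwarding_tree M (old_rule M) \<and> forwarding_tree M (new_rule M)"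

text \<open>The state of a migration is the set of nodes that have applied their update.\<close>

definition rules :: "migration \<Rightarrow> nat set \<Rightarrow> nat \<Rightarrow> nat" where
  "rules M X v = (if v \<in> X then new_rule M v else old_rule M v)"

definition loop_free :: "migration \<Rightarrow> nat set \<Rightarrow> bool" where
  "loop_free M X \<longleftrightarrow> acyclic (forwarding M (rules M X))"

definition migrated :: "migration \<Rightarrow> nat set \<Rightarrow> bool" where
  "migrated M X \<longleftrightarrow> (\<forall>v\<in>nodes M - {dest M}. rules M X v = new_rule M v)"


subsection \<open>Centralized updates\<close>

text \<open>
  A centralized update is a sequence of rounds, given by the sets of nodes that receive an update
  command.  A round starts once all updates of the preceding rounds are acknowledged, so while it
  is in progress the nodes of the preceding rounds, and an arbitrary subset of the nodes of the
  current one, have applied their updates.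
\<close>

definition centralized_update :: "migration \<Rightarrow> nat set list \<Rightarrow> bool" where
  "centralized_update M Rs \<longleftrightarrow>
     (\<forall>R\<in>set Rs. R \<subseteq> nodes M) \<and>
     (\<forall>i<length Rs. \<forall>Y\<subseteq>Rs ! i. loop_free M (\<Union>(set (take i Rs)) \<union> Y)) \<and>
     migrated M (\<Union>(set Rs))"

text \<open>
  The command to a node and its acknowledgement each traverse a shortest path between the
  controller and the node.
\<close>

definition round_delay :: "migration \<Rightarrow> nat set \<Rightarrow> nat" where
  "round_delay M R = Max (insert 0 ((\<lambda>v. 2 * hops M (controller M) v) ` R))"

definition rounds_delay :: "migration \<Rightarrow> nat set list \<Rightarrow> nat" where
  "rounds_delay M Rs = (\<Sum>R\<leftarrow>Rs. round_delay M R)"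

definition centralized_time :: "migration \<Rightarrow> nat" where
  "centralized_time M = (LEAST t. \<exists>Rs. centralized_update M Rs \<and> rounds_delay M Rs = t)"


subsection \<open>Distributed updates\<close>

text \<open>A label is the parent (none for the destination) and the depth in the new tree.\<close>

type_synonym label = "nat option \<times> nat"

definition depth :: "migration \<Rightarrow> nat \<Rightarrow> nat" where
  "depth M v = (LEAST k. (v, dest M) \<in> forwarding M (new_rule M) ^^ k)"

definition label :: "migration \<Rightarrow> nat \<Rightarrow> label" where
  "label M v = (if v = dest M then None else Some (new_rule M v), depth M v)"

text \<open>The local rule of a node \<open>v\<close>, where \<open>X\<close> are the nodes it knows to have updated.\<close>

definition ready :: "(nat \<Rightarrow> label) \<Rightarrow> nat set \<Rightarrow> nat \<Rightarrow> bool" where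
  "ready l X v \<longleftrightarrow>
     (case l v of
        (None, k) \<Rightarrow> k = 0
      | (Some w, k) \<Rightarrow> w \<in> X \<and> k = snd (l w) + 1)"

text \<open>The states that distributed updates can reach when message delays are arbitrary.\<close>

inductive distributed_reachable :: "migration \<Rightarrow> nat set \<Rightarrow> bool" for M where
  start: "distributed_reachable M {}"
| apply_update: "distributed_reachable M X \<Longrightarrow> v \<in> nodes M \<Longrightarrow> ready (label M) X v \<Longrightarrow>
     distributed_reachable M (insert v X)"

text \<open>
  The nodes updated by time \<open>t\<close> when each hop takes one time unit: the controller sends all labels
  at time 0, without waiting for any reply, and the label of a node arrives after a shortest path
  has been traversed.  The notification of an update reaches the neighbors one time unit later.
\<close>

primrec updated_by :: "migration \<Rightarrow> nat \<Rightarrow> nat set" where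
  "updated_by M 0 = {v \<in> nodes M. hops M (controller M) v \<le> 0 \<and> ready (label M) {} v}"
| "updated_by M (Suc t) = updated_by M t \<union>
     {v \<in> nodes M. hops M (controller M) v \<le> Suc t \<and> ready (label M) (updated_by M t) v}"

definition distributed_time :: "migration \<Rightarrow> nat" where
  "distributed_time M = (LEAST t. migrated M (updated_by M t))"

definition speedup :: "migration \<Rightarrow> real" where
  "speedup M = real (centralized_time M) / real (distributed_time M)"

end

theory Submission
  imports Defs
begin

text \<open>
  A state that is closed under the new parent function is loop-free: a walk that enters it follows
  new rules only.  Distributed updates only reach closed states, and so does the centralized
  update whose \<open>i\<close>-th round consists of the nodes of new depth \<open>i\<close> with differing rules (up to nodes
  whose two rules agree).  The latter has at most \<open>n\<close> rounds, and each takes at most twice the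
  distributed time, because a node cannot update before its label arrives.

  The bound is attained by a cycle through the destination whose orientation is reversed, with the
  controller at the end of a path of length about \<open>n/2\<close> attached to the destination.  A node of the
  cycle that updates before its new parent forms a loop with it, so the nodes update one by one
  and each costs a round trip to the controller, whereas the distributed updates take linear time.
\<close>

section \<open>Forwarding trees\<close>

text \<open>Generalizes \<open>depth\<close> to any parent function, so that old and new trees share
  one recursion.\<close>

definition path_length :: "migration \<Rightarrow> (nat \<Rightarrow> nat) \<Rightarrow> nat \<Rightarrow> nat" where
  "path_length M p v = (LEAST k. (v, dest M) \<in> forwarding M p ^^ k)"

lemma depth_eq_path_length: "depth M v = path_length M (new_rule M) v"
  by (simp add: depth_def path_length_def)

lemma path_length_dest [simp]: "path_length M p (dest M) = 0"
  unfolding path_length_def by (rule Least_eq_0) simp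

lemma depth_dest [simp]: "depth M (dest M) = 0"
  by (simp add: depth_eq_path_length)

lemma tree_parent_in_nodes:
  assumes "network_wf M" "forwarding_tree M p" "v \<in> nodes M" "v \<noteq> dest M"
  shows "p v \<in> nodes M"
proof -
  have "(v, p v) \<in> forwarding M p"
    using assms by (auto simp: forwarding_def)
  then show ?thesis
    using assms by (auto simp: forwarding_tree_def network_wf_def)
qed

lemma path_length_step:
  assumes wf: "network_wf M" and tree: "forwarding_tree M p"
    and v: "v \<in> nodes M" "v \<noteq> dest M"
  shows "path_length M p v = Suc (path_length M p (p v))"
proof -
  let ?F = "forwarding M p"
  have path: "(u, dest M) \<in> ?F ^^ path_length M p u" if "u \<in> nodes M" for u
  proof -
    from tree that have "\<exists>k. (u, dest M) \<in> ?F ^^ k"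
      by (auto simp: forwarding_tree_def rtrancl_power)
    then show ?thesis
      unfolding path_length_def by (rule LeastI_ex)
  qed
  have least: "path_length M p u \<le> k" if "(u, dest M) \<in> ?F ^^ k" for u k
    using that unfolding path_length_def by (rule Least_le)
  from path[OF v(1)] v(2) obtain j where j: "path_length M p v = Suc j"
    by (cases "path_length M p v") auto
  with path[OF v(1)] obtain y where "(v, y) \<in> ?F" "(y, dest M) \<in> ?F ^^ j"
    using relpow_Suc_D2 by fastforce
  then have "path_length M p (p v) \<le> j"
    using least by (auto simp: forwarding_def)
  moreover have "(v, dest M) \<in> ?F ^^ Suc (path_length M p (p v))"
    using v path[OF tree_parent_in_nodes[OF wf tree v]]
    by (intro relpow_Suc_I2[of v "p v"]) (auto simp: forwarding_def)
  then have "path_length M p v \<le> Suc (path_length M p (p v))"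
    by (rule least)
  ultimately show ?thesis
    using j by simp
qed

lemma depth_step:
  assumes "migration_wf M" "v \<in> nodes M" "v \<noteq> dest M"
  shows "depth M v = Suc (depth M (new_rule M v))"
  using assms path_length_step[of M "new_rule M" v]
  by (simp add: migration_wf_def depth_eq_path_length)

lemma new_rule_in_nodes:
  assumes "migration_wf M" "v \<in> nodes M" "v \<noteq> dest M"
  shows "new_rule M v \<in> nodes M"
  using assms tree_parent_in_nodes by (auto simp: migration_wf_def)

text \<open>Depth drops by exactly 1 along the new path from \<open>v\<close>, so every value up to
  \<open>depth M v\<close> is the depth of some node.\<close>

lemma depth_less_card:
  assumes M: "migration_wf M" and v: "v \<in> nodes M"
  shows "depth M v < card (nodes M)"
proof -
  have "{..depth M v} \<subseteq> depth M ` nodes M" if "v \<in> nodes M" for v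
    using that
  proof (induction "depth M v" arbitrary: v)
    case 0
    then show ?case by force
  next
    case (Suc k)
    then have "v \<noteq> dest M" by auto
    with Suc depth_step[OF M] new_rule_in_nodes[OF M]
    have "{..depth M (new_rule M v)} \<subseteq> depth M ` nodes M" "depth M (new_rule M v) = k"
      by auto
    moreover have "{..depth M v} = insert (depth M v) {..k}"
      using Suc.hyps(2) by (auto simp: atMost_Suc)
    ultimately show ?case
      using Suc.prems by auto
  qed
  moreover have fin: "finite (nodes M)"
    using M by (simp add: migration_wf_def network_wf_def)
  ultimately have "card {..depth M v} \<le> card (depth M ` nodes M)"
    using v by (intro card_mono) auto
  also have "\<dots> \<le> card (nodes M)"
    by (rule card_image_le[OF fin])
  finally show ?thesis by simp
qed

text \<open>A potential that falls at every non-destination node leaves the destination as the only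
  place where a walk can stop.\<close>

lemma forwarding_treeI:
  fixes \<mu> :: "nat \<Rightarrow> nat"
  assumes links: "forwarding M p \<subseteq> links M"
    and step: "\<And>v. v \<in> nodes M \<Longrightarrow> v \<noteq> dest M \<Longrightarrow> p v \<in> nodes M \<and> \<mu> (p v) < \<mu> v"
  shows "forwarding_tree M p"
proof -
  have "(v, dest M) \<in> (forwarding M p)\<^sup>*" if "v \<in> nodes M" for v
    using that
  proof (induction v rule: measure_induct_rule[of \<mu>])
    case (less v)
    show ?case
    proof (cases "v = dest M")
      case False
      then have "(v, p v) \<in> forwarding M p"
        using less.prems by (auto simp: forwarding_def)
      then show ?thesis
        using less step False by (meson converse_rtrancl_into_rtrancl)
    qed simp
  qed
  with links show ?thesis
    by (simp add: forwarding_tree_def)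
qed


section \<open>Loop freedom\<close>

text \<open>
  Following a rule decreases the length of the new path inside \<open>Z\<close>, and the length of the old path
  until \<open>Z\<close> is entered.
\<close>

lemma loop_free_closed:
  assumes M: "migration_wf M"
    and closed: "\<And>v. v \<in> Z \<Longrightarrow> v \<in> nodes M \<Longrightarrow> v \<noteq> dest M \<Longrightarrow> new_rule M v \<in> Z"
    and XZ: "X \<subseteq> Z"
    and unchanged: "\<And>v. v \<in> Z - X \<Longrightarrow> v \<in> nodes M \<Longrightarrow> v \<noteq> dest M \<Longrightarrow> old_rule M v = new_rule M v"
  shows "loop_free M X"
proof -
  define f where "f v = (if v \<in> Z then (0::nat, path_length M (new_rule M) v)
                         else (1, path_length M (old_rule M) v))" for v
  have "forwarding M (rules M X) \<subseteq> (inv_image (less_than <*lex*> less_than) f)\<inverse>"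
  proof
    fix e assume "e \<in> forwarding M (rules M X)"
    then obtain v where e: "e = (v, rules M X v)" and v: "v \<in> nodes M" "v \<noteq> dest M"
      by (auto simp: forwarding_def)
    have steps: "path_length M (new_rule M) v = Suc (path_length M (new_rule M) (new_rule M v))"
      "path_length M (old_rule M) v = Suc (path_length M (old_rule M) (old_rule M v))"
      using M v path_length_step by (auto simp: migration_wf_def)
    \<comment> \<open>On \<open>Z - X\<close> both rules agree, so the forwarding behaves as if all
      of \<open>Z\<close> had updated.\<close>
    have "rules M X v = (if v \<in> Z then new_rule M v else old_rule M v)"
      using XZ unchanged[of v] v by (auto simp: rules_def)
    then show "e \<in> (inv_image (less_than <*lex*> less_than) f)\<inverse>"
      using steps closed[of v] v by (auto simp: e f_def)
  qed
  moreover have "acyclic ((inv_image (less_than <*lex*> less_than) f)\<inverse>)"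
    unfolding acyclic_converse by (intro wf_acyclic wf_inv_image wf_lex_prod wf_less_than)
  ultimately show ?thesis
    unfolding loop_free_def by (rule acyclic_subset[rotated])
qed

lemma distributed_reachable_loop_free:
  assumes M: "migration_wf M" and X: "distributed_reachable M X"
  shows "loop_free M X"
proof (rule loop_free_closed[OF M, where Z = X])
  show "new_rule M v \<in> X" if "v \<in> X" "v \<noteq> dest M" for v
    using X that
    by (induction) (auto simp: ready_def label_def split: if_splits)
qed auto


section \<open>Termination of both kinds of updates\<close>

definition changed :: "migration \<Rightarrow> nat set" where
  "changed M = {v \<in> nodes M - {dest M}. old_rule M v \<noteq> new_rule M v}"

lemma migrated_iff: "migrated M X \<longleftrightarrow> changed M \<subseteq> X"
  by (auto simp: migrated_def rules_def changed_def)

text \<open>The restriction to \<open>changed\<close> serves the time bound: \<open>migrated\<close>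
  forces only these nodes to have updated, so \<open>distributed_time\<close> bounds only their
  distance to the controller.\<close>

definition depth_rounds :: "migration \<Rightarrow> nat set list" where
  "depth_rounds M = map (\<lambda>i. {v \<in> changed M. depth M v = i}) [0..<card (nodes M)]"

lemma centralized_update_depth_rounds:
  assumes M: "migration_wf M"
  shows "centralized_update M (depth_rounds M)"
  unfolding centralized_update_def
proof (intro conjI allI impI ballI)
  show "R \<subseteq> nodes M" if "R \<in> set (depth_rounds M)" for R
    using that by (auto simp: depth_rounds_def changed_def)
next
  fix i Y
  assume i: "i < length (depth_rounds M)" and Y: "Y \<subseteq> depth_rounds M ! i"
  have pre: "\<Union>(set (take i (depth_rounds M))) = {v \<in> changed M. depth M v < i}"
    using i by (auto simp: depth_rounds_def take_map)
  have Y': "Y \<subseteq> {v \<in> changed M. depth M v = i}"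
    using i Y by (auto simp: depth_rounds_def)
  show "loop_free M (\<Union>(set (take i (depth_rounds M))) \<union> Y)"
  \<comment> \<open>\<open>Z\<close> adds the unchanged nodes of depth below \<open>i\<close>. A
    node of \<open>Y\<close> has depth \<open>i\<close>, so its new parent has smaller depth and
    lies in \<open>Z\<close>.\<close>
  proof (rule loop_free_closed[OF M, where Z = "{v. depth M v < i} \<union> Y"])
    fix v assume "v \<in> {v. depth M v < i} \<union> Y" "v \<in> nodes M" "v \<noteq> dest M"
    then show "new_rule M v \<in> {v. depth M v < i} \<union> Y"
      using depth_step[OF M, of v] Y' by auto
  qed (auto simp: pre changed_def)
next
  show "migrated M (\<Union>(set (depth_rounds M)))"
    using depth_less_card[OF M] by (auto simp: migrated_iff depth_rounds_def changed_def)
qed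

lemma updated_by_hops: "v \<in> updated_by M t \<Longrightarrow> hops M (controller M) v \<le> t"
  by (induction t) auto

text \<open>By time \<open>H\<close> all labels have arrived; from then on at least one further
  level of the new tree updates per time unit.\<close>

lemma updated_by_depth:
  assumes M: "migration_wf M" and v: "v \<in> nodes M"
    and H: "\<And>u. u \<in> nodes M \<Longrightarrow> hops M (controller M) u \<le> H"
  shows "v \<in> updated_by M (H + depth M v)"
  using v
proof (induction "depth M v" arbitrary: v)
  case 0
  then have "v = dest M"
    using depth_step[OF M, of v] by auto
  then have "ready (label M) X v" for X
    by (simp add: ready_def label_def)
  then show ?case
    using 0 H by (cases H) auto
next
  case (Suc k)
  then have nd: "v \<noteq> dest M" by auto
  let ?w = "new_rule M v"
  have k: "depth M ?w = k"
    using depth_step[OF M Suc.prems nd] Suc.hyps by simp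
  then have "?w \<in> updated_by M (H + k)"
    using Suc new_rule_in_nodes[OF M Suc.prems nd] by auto
  then have "ready (label M) (updated_by M (H + k)) v"
    using nd k Suc.hyps by (simp add: ready_def label_def)
  moreover have "hops M (controller M) v \<le> Suc (H + k)"
    using H[OF Suc.prems] by simp
  ultimately show ?case
    using Suc by (simp flip: Suc.hyps(2))
qed

lemma updated_by_mono:
  assumes "s \<le> t"
  shows "updated_by M s \<subseteq> updated_by M t"
  using lift_Suc_mono_le[of "updated_by M" s t] assms by auto

lemma migrated_updated_by:
  assumes M: "migration_wf M"
    and H: "\<And>u. u \<in> nodes M \<Longrightarrow> hops M (controller M) u \<le> H"
  shows "migrated M (updated_by M (H + card (nodes M)))"
proof -
  have "v \<in> updated_by M (H + card (nodes M))" if "v \<in> nodes M" for v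
    using updated_by_depth[OF M that H] depth_less_card[OF M that]
      updated_by_mono[of "H + depth M v" "H + card (nodes M)"] by auto
  then show ?thesis
    by (auto simp: migrated_iff changed_def)
qed

lemma distributed_terminates:
  assumes M: "migration_wf M"
  shows "\<exists>t. migrated M (updated_by M t)"
proof -
  have "finite (nodes M)"
    using M by (simp add: migration_wf_def network_wf_def)
  then have "hops M (controller M) u \<le> Max (hops M (controller M) ` nodes M)"
    if "u \<in> nodes M" for u
    using that by simp
  then show ?thesis
    using migrated_updated_by[OF M] by blast
qed


section \<open>The upper bound on the speed up\<close>

lemma round_delay_le:
  assumes "finite R" "\<And>v. v \<in> R \<Longrightarrow> hops M (controller M) v \<le> t"
  shows "round_delay M R \<le> 2 * t"
  using assms by (auto simp: round_delay_def)

lemma centralized_time_le: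
  assumes M: "migration_wf M"
  shows "centralized_time M \<le> 2 * card (nodes M) * distributed_time M"
proof -
  have "migrated M (updated_by M (distributed_time M))"
    unfolding distributed_time_def using distributed_terminates[OF M] by (rule LeastI_ex)
  then have near: "hops M (controller M) v \<le> distributed_time M" if "v \<in> changed M" for v
    using that updated_by_hops by (auto simp: migrated_iff)
  have "finite (changed M)"
    using M by (simp add: changed_def migration_wf_def network_wf_def)
  then have "round_delay M {v \<in> changed M. depth M v = i} \<le> 2 * distributed_time M" for i
    using near by (intro round_delay_le) auto
  then have "rounds_delay M (depth_rounds M) \<le>
      (\<Sum>i\<leftarrow>[0..<card (nodes M)]. 2 * distributed_time M)"
    unfolding rounds_delay_def depth_rounds_def map_map
    by (intro sum_list_mono) auto
  also have "\<dots> = 2 * card (nodes M) * distributed_time M"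
    by (simp add: sum_list_triv)
  also have "centralized_time M \<le> rounds_delay M (depth_rounds M)"
    unfolding centralized_time_def
    using centralized_update_depth_rounds[OF M] by (intro Least_le) auto
  finally (xtrans) show ?thesis .
qed

lemma speedup_le:
  assumes "migration_wf M"
  shows "speedup M \<le> 2 * real (card (nodes M))"
proof -
  have "real (centralized_time M) \<le> 2 * real (card (nodes M)) * real (distributed_time M)"
    using centralized_time_le[OF assms] by (metis of_nat_le_iff of_nat_mult of_nat_numeral)
  then show ?thesis
    \<comment> \<open>Division by 0 yields 0, so the bound is trivial in the first case.\<close>
    by (cases "distributed_time M = 0") (auto simp: speedup_def field_simps)
qed


section \<open>Migrations with linear speed up\<close>

text \<open>The nodes \<open>0..p\<close> form the path from the controller to the destination
  \<open>p\<close>; the nodes \<open>p..n - 1\<close> form the cycle, closed by the link between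
  \<open>n - 1\<close> and \<open>p\<close>. Path nodes keep their rules; the others forward upwards
  before and downwards after the migration.\<close>

definition cycle_reversal :: "nat \<Rightarrow> nat \<Rightarrow> migration" where
  "cycle_reversal n p = \<lparr>
     nodes = {..<n},
     links = {(u, v). u < n \<and> v < n \<and>
                (v = Suc u \<or> u = Suc v \<or> (u = p \<and> v = n - 1) \<or> (u = n - 1 \<and> v = p))},
     controller = 0,
     dest = p,
     old_rule = (\<lambda>v. if v = n - 1 then p else Suc v),
     new_rule = (\<lambda>v. if v < p then Suc v else v - 1)\<rparr>"

lemma cycle_reversal_simps [simp]:
  "nodes (cycle_reversal n p) = {..<n}"
  "controller (cycle_reversal n p) = 0"
  "dest (cycle_reversal n p) = p"
  "old_rule (cycle_reversal n p) v = (if v = n - 1 then p else Suc v)"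
  "new_rule (cycle_reversal n p) v = (if v < p then Suc v else v - 1)"
  by (simp_all add: cycle_reversal_def)

lemma links_cycle_reversal:
  "(u, v) \<in> links (cycle_reversal n p) \<longleftrightarrow> u < n \<and> v < n \<and>
     (v = Suc u \<or> u = Suc v \<or> (u = p \<and> v = n - 1) \<or> (u = n - 1 \<and> v = p))"
  by (simp add: cycle_reversal_def)

lemma relpow_links_cycle_reversal:
  "v < n \<Longrightarrow> (0, v) \<in> links (cycle_reversal n p) ^^ v"
  by (induction v) (auto simp: links_cycle_reversal)

lemma cycle_reversal_wf:
  assumes p: "p < n - 1"
  shows "migration_wf (cycle_reversal n p)"
proof -
  let ?M = "cycle_reversal n p"
  have sym: "sym (links ?M)"
    by (auto simp: sym_def links_cycle_reversal)
  have from0: "(0, v) \<in> (links ?M)\<^sup>*" if "v < n" for v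
    using relpow_links_cycle_reversal[OF that] by (rule relpow_imp_rtrancl)
  have "(u, v) \<in> (links ?M)\<^sup>*" if "u < n" "v < n" for u v
    using from0[OF that(1)] from0[OF that(2)] sym_rtrancl[OF sym]
    by (meson rtrancl_trans symD)
  moreover have "links ?M \<subseteq> nodes ?M \<times> nodes ?M" "irrefl (links ?M)"
    using p by (auto simp: links_cycle_reversal irrefl_def)
  ultimately have "network_wf ?M"
    using sym p by (auto simp: network_wf_def)
  \<comment> \<open>Both potentials are the exact distances to \<open>p\<close> along the respective
    rules.\<close>
  moreover have "forwarding_tree ?M (old_rule ?M)"
    using p
    by (intro forwarding_treeI[where \<mu> = "\<lambda>v. if v \<le> p then p - v else n - v"])
      (auto simp: forwarding_def links_cycle_reversal)
  moreover have "forwarding_tree ?M (new_rule ?M)"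
    using p
    by (intro forwarding_treeI[where \<mu> = "\<lambda>v. if v \<le> p then p - v else v - p"])
      (auto simp: forwarding_def links_cycle_reversal)
  ultimately show ?thesis
    using p by (simp add: migration_wf_def)
qed

lemma hops_cycle_reversal_le: "v < n \<Longrightarrow> hops (cycle_reversal n p) 0 v \<le> v"
  unfolding hops_def by (intro Least_le relpow_links_cycle_reversal)

text \<open>The distance to the controller is at least \<open>min v p\<close>, which no link changes by more than 1.\<close>

lemma hops_cycle_reversal_ge:
  assumes p: "p < n - 1" and v: "v < n" "p \<le> v"
  shows "p \<le> hops (cycle_reversal n p) 0 v"
proof -
  have "min u p \<le> k" if "(0, u) \<in> links (cycle_reversal n p) ^^ k" for k u
    using that
  proof (induction k arbitrary: u)
    case (Suc k)
    then obtain w where "min w p \<le> k" "(w, u) \<in> links (cycle_reversal n p)"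
      by auto
    \<comment> \<open>The closing link joins \<open>p\<close> and \<open>n - 1\<close>, where
      \<open>min\<close> has the same value \<open>p\<close>.\<close>
    then show ?case
      using p by (auto simp: links_cycle_reversal)
  qed auto
  moreover have "(0, v) \<in> links (cycle_reversal n p) ^^ hops (cycle_reversal n p) 0 v"
    unfolding hops_def using relpow_links_cycle_reversal[OF v(1)] by (rule LeastI)
  ultimately show ?thesis
    using v by fastforce
qed

text \<open>One \<open>n\<close> pays for the arrival of the labels, the other for the depth of the
  new tree.\<close>

lemma distributed_time_cycle_reversal:
  assumes "p < n - 1"
  shows "distributed_time (cycle_reversal n p) \<le> 2 * n"
proof -
  have "migrated (cycle_reversal n p) (updated_by (cycle_reversal n p) (n + n))"
    using migrated_updated_by[OF cycle_reversal_wf[OF assms], of n] hops_cycle_reversal_le[of _ n p]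
    by fastforce
  then show ?thesis
    unfolding distributed_time_def by (intro Least_le) (simp add: mult_2)
qed

text \<open>Otherwise \<open>v\<close> still forwards to \<open>Suc v\<close> by its old rule, while
  \<open>Suc v\<close> already forwards back to \<open>v\<close>.\<close>

lemma loop_free_cycle_reversal_parent:
  assumes "loop_free (cycle_reversal n p) X" "Suc v \<in> X" "p < v" "Suc v < n"
  shows "v \<in> X"
proof (rule ccontr)
  assume "v \<notin> X"
  let ?F = "forwarding (cycle_reversal n p) (rules (cycle_reversal n p) X)"
  have "(v, Suc v) \<in> ?F" "(Suc v, v) \<in> ?F"
    using assms \<open>v \<notin> X\<close> by (auto simp: forwarding_def rules_def)
  then have "(v, v) \<in> ?F\<^sup>+"
    by (meson trancl.simps)
  then show False
    using assms by (auto simp: loop_free_def acyclic_def)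
qed

lemma rounds_delay_cycle_reversal:
  assumes p: "p < n - 1" and upd: "centralized_update (cycle_reversal n p) Rs"
  shows "(n - 2 - p) * (2 * p) \<le> rounds_delay (cycle_reversal n p) Rs"
proof -
  let ?M = "cycle_reversal n p"
  \<comment> \<open>Without \<open>n - 1\<close>, whose old rule is the closing link, each node has
    old rule \<open>Suc v\<close> and new rule \<open>v - 1\<close>. There are
    \<open>n - 2 - p\<close> such nodes.\<close>
  let ?C = "{p<..<n - 1}"
  define first where "first v = (LEAST i. i < length Rs \<and> v \<in> Rs ! i)" for v
  have "?C \<subseteq> changed ?M"
    by (auto simp: changed_def)
  then have "?C \<subseteq> \<Union>(set Rs)"
    using upd by (auto simp: centralized_update_def migrated_iff)
  then have "\<exists>R\<in>set Rs. v \<in> R" if "v \<in> ?C" for v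
    using that by blast
  then have "\<exists>i. i < length Rs \<and> v \<in> Rs ! i" if "v \<in> ?C" for v
    using that unfolding in_set_conv_nth Bex_def by blast
  then have first: "first v < length Rs \<and> v \<in> Rs ! first v" if "v \<in> ?C" for v
    unfolding first_def by (rule LeastI_ex) (use that in blast)
  have step: "first v < first (Suc v)" if v: "v \<in> ?C" "Suc v \<in> ?C" for v
  proof -
    let ?i = "first (Suc v)"
    have "loop_free ?M (\<Union>(set (take i Rs)) \<union> Y)" if "i < length Rs" "Y \<subseteq> Rs ! i" for i Y
      using upd that by (simp add: centralized_update_def)
    \<comment> \<open>Asynchrony allows \<open>Suc v\<close> to be the first of its round to update,
      so \<open>v\<close> must belong to an earlier round.\<close>
    then have "loop_free ?M (\<Union>(set (take ?i Rs)) \<union> {Suc v})"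
      using first[OF v(2)] by blast
    then have "v \<in> \<Union>(set (take ?i Rs)) \<union> {Suc v}"
      using v by (auto dest: loop_free_cycle_reversal_parent)
    then obtain j where "j < ?i" "j < length Rs" "v \<in> Rs ! j"
      by (auto simp: in_set_conv_nth)
    moreover from this have "first v \<le> j"
      unfolding first_def by (intro Least_le) simp
    ultimately show ?thesis by simp
  qed
  have less: "first u < first v" if "u < v" "u \<in> ?C" "v \<in> ?C" for u v
    using that
  proof (induction v)
    case (Suc v)
    show ?case
    proof (cases "u = v")
      case False
      with Suc have "first u < first v" "first v < first (Suc v)"
        by (auto intro!: step)
      then show ?thesis by simp
    qed (use Suc step in auto)
  qed simp
  \<comment> \<open>Distinct nodes start in distinct rounds, so their delays add up.\<close>
  have inj: "inj_on first ?C"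
    by (rule linorder_inj_onI) (use less in force)+
  have delay: "2 * p \<le> round_delay ?M (Rs ! first v)" if v: "v \<in> ?C" for v
  proof -
    have "Rs ! first v \<subseteq> {..<n}"
      using upd first[OF v] by (auto simp: centralized_update_def)
    then have "finite (Rs ! first v)"
      by (rule finite_subset) simp
    then have "2 * hops ?M 0 v \<le> round_delay ?M (Rs ! first v)"
      using first[OF v] by (auto simp: round_delay_def intro!: Max_ge)
    moreover have "p \<le> hops ?M 0 v"
      using p v by (intro hops_cycle_reversal_ge) auto
    ultimately show ?thesis by simp
  qed
  have "(n - 2 - p) * (2 * p) = (\<Sum>v\<in>?C. 2 * p)"
    by simp
  also have "\<dots> \<le> (\<Sum>v\<in>?C. round_delay ?M (Rs ! first v))"
    using delay by (rule sum_mono)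
  also have "\<dots> = (\<Sum>i\<in>first ` ?C. round_delay ?M (Rs ! i))"
    by (subst sum.reindex[OF inj]) simp
  also have "\<dots> \<le> (\<Sum>i<length Rs. round_delay ?M (Rs ! i))"
    using first by (intro sum_mono2) auto
  also have "\<dots> = rounds_delay ?M Rs"
    by (simp add: rounds_delay_def sum_list_sum_nth atLeast0LessThan)
  finally show ?thesis .
qed

lemma centralized_time_cycle_reversal:
  assumes p: "p < n - 1"
  shows "(n - 2 - p) * (2 * p) \<le> centralized_time (cycle_reversal n p)"
proof -
  let ?M = "cycle_reversal n p"
  \<comment> \<open>Some valid update exists, so the \<open>LEAST\<close> in
    \<open>centralized_time\<close> is attained.\<close>
  have "\<exists>t Rs. centralized_update ?M Rs \<and> rounds_delay ?M Rs = t"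
    using centralized_update_depth_rounds[OF cycle_reversal_wf[OF p]] by blast
  then have "\<exists>Rs. centralized_update ?M Rs \<and> rounds_delay ?M Rs = centralized_time ?M"
    unfolding centralized_time_def by (rule LeastI_ex)
  then show ?thesis
    using rounds_delay_cycle_reversal[OF p] by metis
qed

text \<open>With \<open>p = n div 2\<close> both factors of the centralized bound are linear: at
  least \<open>n / 4\<close> and \<open>n / 2\<close> once \<open>n \<ge> 12\<close>. Dividing their
  product by \<open>2 * n\<close> gives \<open>n / 16\<close>.\<close>

lemma speedup_cycle_reversal_ge:
  assumes n: "n \<ge> 12"
  shows "real n / 16 \<le> speedup (cycle_reversal n (n div 2))"
proof -
  let ?M = "cycle_reversal n (n div 2)"
  have p: "n div 2 < n - 1"
    using n by simp
  have "real n / 4 * (real n / 2) \<le> real (n - 2 - n div 2) * real (2 * (n div 2))"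
    using n by (intro mult_mono) linarith+
  also have "\<dots> \<le> real (centralized_time ?M)"
    using centralized_time_cycle_reversal[OF p] by (metis of_nat_le_iff of_nat_mult)
  finally have c: "real n / 4 * (real n / 2) \<le> real (centralized_time ?M)" .
  \<comment> \<open>A zero distributed time would make the quotient 0; the upper bound excludes it
    because the centralized time is positive.\<close>
  have "real n / 4 * (real n / 2) > 0"
    using n by simp
  with c have "centralized_time ?M > 0"
    by linarith
  then have d: "distributed_time ?M > 0"
    using centralized_time_le[OF cycle_reversal_wf[OF p]] by (cases "distributed_time ?M = 0") auto
  have "real n / 16 * real (distributed_time ?M) \<le> real n / 16 * real (2 * n)"
    using distributed_time_cycle_reversal[OF p] by (intro mult_left_mono) linarith+
  also have "\<dots> \<le> real (centralized_time ?M)"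
    using c by simp
  finally show ?thesis
    using d by (simp add: speedup_def pos_le_divide_eq)
qed

lemma speedup_cycle_reversal_bigtheta:
  "(\<lambda>n. speedup (cycle_reversal n (n div 2))) \<in> \<Theta>(\<lambda>n. real n)"
proof (rule bigthetaI)
  show "(\<lambda>n. speedup (cycle_reversal n (n div 2))) \<in> O(\<lambda>n. real n)"
  proof (rule bigoI)
    show "\<forall>\<^sub>F n in at_top. norm (speedup (cycle_reversal n (n div 2))) \<le> 2 * norm (real n)"
      \<comment> \<open>From 3 on, \<open>n div 2 < n - 1\<close>, as well-formedness
        requires.\<close>
      using eventually_ge_at_top[of 3]
    proof eventually_elim
      case (elim n)
      then have "speedup (cycle_reversal n (n div 2)) \<le> 2 * real n"
        using speedup_le[OF cycle_reversal_wf[of "n div 2" n]] by simp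
      then show ?case
        by (simp add: speedup_def)
    qed
  qed
  show "(\<lambda>n. speedup (cycle_reversal n (n div 2))) \<in> \<Omega>(\<lambda>n. real n)"
  proof (rule landau_omega.bigI)
    show "\<forall>\<^sub>F n in at_top. norm (speedup (cycle_reversal n (n div 2))) \<ge> 1 / 16 * norm (real n)"
      using eventually_ge_at_top[of 12]
    proof eventually_elim
      case (elim n)
      then show ?case
        using speedup_cycle_reversal_ge[OF elim] by simp
    qed
  qed simp
qed

theorem mainTheorem3:
  shows "(\<forall>M. migration_wf M \<longrightarrow>
            (\<exists>Rs. centralized_update M Rs) \<and>
            (\<forall>X. distributed_reachable M X \<longrightarrow> loop_free M X) \<and>
            (\<exists>t. migrated M (updated_by M t)))
       \<and> (\<exists>C>0. \<forall>M. migration_wf M \<longrightarrow>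
            real (centralized_time M) \<le> C * real (card (nodes M)) * real (distributed_time M))
       \<and> (\<exists>M :: nat \<Rightarrow> migration.
            (\<forall>n\<ge>3. migration_wf (M n) \<and> card (nodes (M n)) = n) \<and>
            (\<lambda>n. speedup (M n)) \<in> \<Theta>(\<lambda>n. real n))"
proof (intro conjI)
  show "\<forall>M. migration_wf M \<longrightarrow>
            (\<exists>Rs. centralized_update M Rs) \<and>
            (\<forall>X. distributed_reachable M X \<longrightarrow> loop_free M X) \<and>
            (\<exists>t. migrated M (updated_by M t))"
    using centralized_update_depth_rounds distributed_reachable_loop_free distributed_terminates
    by blast
  \<comment> \<open>In product form the bound is also meaningful for distributed time 0, where it
    forces centralized time 0.\<close>
  have "real (centralized_time M) \<le> 2 * real (card (nodes M)) * real (distributed_time M)"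
    if "migration_wf M" for M
    using centralized_time_le[OF that] by (metis of_nat_le_iff of_nat_mult of_nat_numeral)
  then show "\<exists>C>0. \<forall>M. migration_wf M \<longrightarrow>
            real (centralized_time M) \<le> C * real (card (nodes M)) * real (distributed_time M)"
    by (intro exI[of _ 2]) auto
  have "\<forall>n\<ge>3. migration_wf (cycle_reversal n (n div 2)) \<and>
          card (nodes (cycle_reversal n (n div 2))) = n"
    by (auto intro!: cycle_reversal_wf)
  with speedup_cycle_reversal_bigtheta
  show "\<exists>M :: nat \<Rightarrow> migration.
            (\<forall>n\<ge>3. migration_wf (M n) \<and> card (nodes (M n)) = n) \<and>
            (\<lambda>n. speedup (M n)) \<in> \<Theta>(\<lambda>n. real n)"
    by (intro exI[of _ "\<lambda>n. cycle_reversal n (n div 2)"]) auto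
qed

end
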